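(* Let $\alpha>0$ be known, $n_0>0$ and $l_0\in\mathbb{R}$. Let $X=(x_1,\dots,x_n)$, $n\ge 1$, be real observations that are i.i.d. given a location parameter $l\in\mathbb{R}$, each with the shifted exponential density $p(x_i\mid l)=\mathrm{Exp}(x_i\mid\alpha,l)$. Suppose $l$ has prior distribution $\mathrm{LogPower}(l_0,\alpha n_0)$. Then the posterior distribution of $l$ given $X$ is $$p(l\mid X)=\mathrm{LogPower}\big(l\mid l_n,\ \alpha(n+n_0)\big),\qquad l_n=\min\Big(l_0,\ \min_{1\le i\le n}x_i\Big).$$ In particular the LogPower family is a conjugate prior family for the lower bound $l$ of the shifted exponential distribution with known $\alpha$.
   Context: For $\alpha>0$ and $l\in\mathbb{R}$, $\mathrm{Exp}(x\mid\alpha,l)=\alpha e^{-\alpha(x-l)}$ for $x>l$ and $0$ otherwise. For $a\in\mathbb{R}$ and $b>0$, $\mathrm{LogPower}(x\mid a,b)=b\,e^{b(x-a)}$ for $x<a$ and $0$ otherwise. The posterior density is $p(l\mid X)=p(X\mid l)p(l)\big/\int p(X\mid l)p(l)\,dl$ with $p(X\mid l)=\prod_i p(x_i\mid l)$; densities are identified when they agree almost everywhere. A prior is conjugate for a sampling distribution if the posterior belongs to the same parametric family as the prior. *)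

theory Defs
  imports "HOL-Analysis.Analysis"
begin

(* Strict inequality at the boundary, unlike exponential_density in HOL-Probability. *)
definition Exp_density :: "real \<Rightarrow> real \<Rightarrow> real \<Rightarrow> real" where
  "Exp_density \<alpha> l x = (if x > l then \<alpha> * exp (- \<alpha> * (x - l)) else 0)"

definition LogPower_density :: "real \<Rightarrow> real \<Rightarrow> real \<Rightarrow> real" where
  "LogPower_density a b x = (if x < a then b * exp (b * (x - a)) else 0)"

(* A sampling density p takes the parameter first: p l x stands for p(x | l).
   A sample of size n is given by the values x 1, ..., x n. *)
definition likelihood :: "(real \<Rightarrow> real \<Rightarrow> real) \<Rightarrow> nat \<Rightarrow> (nat \<Rightarrow> real) \<Rightarrow> real \<Rightarrow> real" where
  "likelihood p n x l = (\<Prod>i=1..n. p l (x i))"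

(* If the normalising integral is zero or does not exist, this is the zero function, which
   does not agree almost everywhere with any probability density. *)
definition posterior_density ::
    "(real \<Rightarrow> real \<Rightarrow> real) \<Rightarrow> (real \<Rightarrow> real) \<Rightarrow> nat \<Rightarrow> (nat \<Rightarrow> real) \<Rightarrow> real \<Rightarrow> real" where
  "posterior_density p prior n x l =
     likelihood p n x l * prior l / (\<integral>t. likelihood p n x t * prior t \<partial>lborel)"

(* The family is {f h | h \<in> H}, with hyperparameter set H.  The posterior must be a member of
   the family for every sample; if the family consists of probability densities, this forces the
   normalising integral to exist and be nonzero. *)
definition conjugate_prior_family ::
    "'h set \<Rightarrow> ('h \<Rightarrow> real \<Rightarrow> real) \<Rightarrow> (real \<Rightarrow> real \<Rightarrow> real) \<Rightarrow> bool" where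
  "conjugate_prior_family H f p \<longleftrightarrow>
     (\<forall>h\<in>H. \<forall>n\<ge>1. \<forall>x. \<exists>h'\<in>H. AE l in lborel. posterior_density p (f h) n x l = f h' l)"

end

theory Submission
  imports Defs
begin

text \<open>As a function of \<open>l\<close>, the likelihood is a positive constant times
  exp(\<alpha> n l), cut off at the smallest observation (\<open>likelihood_Exp_density\<close>); a
  LogPower prior of rate b is likewise a multiple of exp(b l), cut off at its threshold. In the
  product the rates add and the smaller cutoff wins, so it is a nonzero multiple of a LogPower
  density. That density has mass 1 (\<open>lborel_integral_LogPower_density\<close>), so the
  normalising integral equals the multiple and cancels (\<open>posterior_density_eqI\<close>).
  Equality holds at every point.\<close>

lemma lborel_integral_LogPower_density:
  assumes "b > 0"
  shows "(\<integral>t. LogPower_density a b t \<partial>lborel) = 1"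
proof -
  have "(LBINT t=-\<infinity>..ereal a. b * exp (b * (t - a))) = 1 - 0"
  \<comment> \<open>Since the integrand is nonnegative, integrability follows from the limits of the
    antiderivative: 0 at minus infinity and 1 at \<open>a\<close>.\<close>
  proof (rule interval_integral_FTC_nonneg(2)[where F = "\<lambda>t. exp (b * (t - a))"])
    have "b * (t - a) \<le> Z" if "t \<le> a + Z / b" for t Z
      using assms that by (simp add: field_simps)
    then have "filterlim (\<lambda>t. b * (t - a)) at_bot at_bot"
      unfolding filterlim_at_bot eventually_at_bot_linorder by blast
    then have "((\<lambda>t. exp (b * (t - a))) \<longlongrightarrow> 0) at_bot"
      by (rule filterlim_compose[OF exp_at_bot])
    then show "(((\<lambda>t. exp (b * (t - a))) \<circ> real_of_ereal) \<longlongrightarrow> 0) (at_right (-\<infinity>))"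
      by (simp add: ereal_tendsto_simps)
    have "((\<lambda>t. exp (b * (t - a))) \<longlongrightarrow> exp (b * (a - a))) (at_left a)"
      by (intro tendsto_intros)
    then show "(((\<lambda>t. exp (b * (t - a))) \<circ> real_of_ereal) \<longlongrightarrow> 1) (at_left (ereal a))"
      by (simp add: ereal_tendsto_simps)
  qed (use assms in \<open>auto intro!: derivative_eq_intros\<close>)
  \<comment> \<open>\<open>einterval\<close> is open, so its indicator is exactly the strict cutoff
    \<open>t < a\<close>.\<close>
  moreover have "(LBINT t=-\<infinity>..ereal a. b * exp (b * (t - a))) = (\<integral>t. LogPower_density a b t \<partial>lborel)"
    unfolding interval_lebesgue_integral_def set_lebesgue_integral_def
    by (auto intro!: Bochner_Integration.integral_cong simp: LogPower_density_def indicator_def einterval_def)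
  ultimately show ?thesis by simp
qed

text \<open>The product survives only if no factor vanishes, that is, if \<open>l\<close> lies
  strictly below every observation; \<open>n \<ge> 1\<close> makes the set under \<open>Min\<close>
  nonempty.\<close>

lemma likelihood_Exp_density:
  assumes "n \<ge> 1"
  shows "likelihood (Exp_density \<alpha>) n x l =
    (if l < Min (x ` {1..n}) then \<alpha> ^ n * exp (\<alpha> * (real n * l - (\<Sum>i=1..n. x i))) else 0)"
proof (cases "l < Min (x ` {1..n})")
  case True
  then have "\<And>i. i \<in> {1..n} \<Longrightarrow> l < x i" by (subst (asm) Min_gr_iff) auto
  then have "likelihood (Exp_density \<alpha>) n x l = (\<Prod>i=1..n. \<alpha> * exp (- \<alpha> * (x i - l)))"
    unfolding likelihood_def Exp_density_def by (intro prod.cong) auto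
  also have "\<dots> = \<alpha> ^ n * exp (\<Sum>i=1..n. - \<alpha> * (x i - l))"
    by (simp add: prod.distrib exp_sum)
  also have "(\<Sum>i=1..n. - \<alpha> * (x i - l)) = \<alpha> * (real n * l - (\<Sum>i=1..n. x i))"
    by (simp only: sum_distrib_left[symmetric] sum_subtractf) (simp add: algebra_simps)
  finally show ?thesis using True by simp
next
  case False
  then obtain i where "i \<in> {1..n}" "\<not> l < x i"
    using assms by (subst (asm) Min_gr_iff) auto
  then show ?thesis
    using False unfolding likelihood_def Exp_density_def by (auto intro!: prod_zero)
qed

text \<open>Normalising by recognising the kernel: the evidence integral is \<open>C\<close> itself.
  A constant factor leaves the real Bochner integral unconditionally, so no integrability premise
  appears.\<close>

lemma posterior_density_eqI:
  assumes "\<And>t. likelihood p n x t * prior t = C * q t"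
    and "C \<noteq> 0" and "(\<integral>t. q t \<partial>lborel) = 1"
  shows "posterior_density p prior n x l = q l"
  using assms by (simp add: posterior_density_def)

text \<open>The rate \<open>b\<close> is arbitrary so that the result serves both the prior with
  rate \<open>\<alpha> * n\<^sub>0\<close> and conjugacy of the whole family.\<close>

lemma posterior_density_Exp_LogPower:
  assumes "\<alpha> > 0" "b > 0" "n \<ge> 1"
  shows "posterior_density (Exp_density \<alpha>) (LogPower_density a b) n x =
    LogPower_density (min a (Min (x ` {1..n}))) (\<alpha> * real n + b)"
proof
  fix l
  let ?m = "min a (Min (x ` {1..n}))" and ?c = "\<alpha> * real n + b"
  \<comment> \<open>The ratio of the prefactors, times what remains of the combined exponent after
    \<open>?c * (t - ?m)\<close> is split off.\<close>
  let ?C = "\<alpha> ^ n * b / ?c * exp (?c * ?m - \<alpha> * (\<Sum>i=1..n. x i) - b * a)"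
  have c: "?c > 0" using assms by (simp add: add_nonneg_pos)
  show "posterior_density (Exp_density \<alpha>) (LogPower_density a b) n x l = LogPower_density ?m ?c l"
  proof (rule posterior_density_eqI[where C = ?C])
    fix t
    have "exp (\<alpha> * (real n * t - (\<Sum>i=1..n. x i))) * exp (b * (t - a))
        = exp (?c * ?m - \<alpha> * (\<Sum>i=1..n. x i) - b * a) * exp (?c * (t - ?m))"
      unfolding exp_add[symmetric] by (simp add: algebra_simps)
    \<comment> \<open>The two cutoffs hold together iff \<open>t < ?m\<close>; otherwise both sides
      are 0.\<close>
    then show "likelihood (Exp_density \<alpha>) n x t * LogPower_density a b t = ?C * LogPower_density ?m ?c t"
      using c unfolding likelihood_Exp_density[OF \<open>n \<ge> 1\<close>] LogPower_density_def
      by (simp add: mult_ac)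
  qed (use assms c in \<open>simp_all add: lborel_integral_LogPower_density\<close>)
qed

theorem mainTheorem1:
  fixes \<alpha> n\<^sub>0 l\<^sub>0 :: real and n :: nat and x :: "nat \<Rightarrow> real"
  assumes "\<alpha> > 0" and "n\<^sub>0 > 0" and "n \<ge> 1"
  shows "(AE l in lborel.
            posterior_density (Exp_density \<alpha>) (LogPower_density l\<^sub>0 (\<alpha> * n\<^sub>0)) n x l =
            LogPower_density (min l\<^sub>0 (Min (x ` {1..n}))) (\<alpha> * (real n + n\<^sub>0)) l)
       \<and> conjugate_prior_family {(a, b). b > 0} (\<lambda>(a, b). LogPower_density a b) (Exp_density \<alpha>)"
proof
  show "AE l in lborel.
            posterior_density (Exp_density \<alpha>) (LogPower_density l\<^sub>0 (\<alpha> * n\<^sub>0)) n x l =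
            LogPower_density (min l\<^sub>0 (Min (x ` {1..n}))) (\<alpha> * (real n + n\<^sub>0)) l"
    using assms by (simp add: posterior_density_Exp_LogPower distrib_left)
  show "conjugate_prior_family {(a, b). b > 0} (\<lambda>(a, b). LogPower_density a b) (Exp_density \<alpha>)"
    unfolding conjugate_prior_family_def
  proof (intro ballI allI impI)
    fix h :: "real \<times> real" and k :: nat and y :: "nat \<Rightarrow> real"
    assume "h \<in> {(a, b). b > 0}" and k: "k \<ge> 1"
    then obtain a b where h: "h = (a, b)" "b > 0" by auto
    show "\<exists>h'\<in>{(a, b). b > 0}. AE l in lborel.
        posterior_density (Exp_density \<alpha>) (case h of (a, b) \<Rightarrow> LogPower_density a b) k y l =
        (case h' of (a, b) \<Rightarrow> LogPower_density a b) l"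
      using h k \<open>\<alpha> > 0\<close>
      \<comment> \<open>The updated hyperparameters: each observation adds \<alpha> to the rate and
        can only lower the threshold.\<close>
      by (intro bexI[of _ "(min a (Min (y ` {1..k})), \<alpha> * real k + b)"])
        (simp_all add: posterior_density_Exp_LogPower add_nonneg_pos)
  qed
qed

end
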